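(* Let $x=e^{i\theta}$ with $\theta\in(0,2\pi)$, let $a\in\mathbb{C}\setminus\mathbb{Z}$ and $m\in\mathbb{N}_0$. Then \[ \mathrm{Li}_{m+1}(x;1-a)-(-1)^m x\,\mathrm{Li}_{m+1}(x^{-1};a)=\frac{\pi}{m!}\frac{d^m}{da^m}\Big(i\,x^a-\cot(\pi a)\,x^a\Big), \] where $i^2=-1$.
   Context: For $p\in\mathbb{N}$, $b\in\mathbb{C}\setminus\{-1,-2,\dots\}$ and $x$ a root of unity or $|x|=1$, $x\ne1$ when $p=1$, $\mathrm{Li}_p(x;b+1):=\sum_{n=1}^\infty\frac{x^n}{(n+b)^p}$. Here $x^a:=e^{ia\theta}$. *)

theory Defs
  imports "HOL-Complex_Analysis.Complex_Analysis"
begin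

text \<open>
  \<open>Li p x c\<close> stands for Li\<open>\<^sub>p(x; c)\<close>, the sum over \<open>n \<ge> 1\<close> of \<open>x\<^sup>n / (n + b)\<^sup>p\<close> where \<open>c = b + 1\<close>.
  The intended domain is \<open>p \<ge> 1\<close>, \<open>b\<close> not a negative integer, \<open>\<bar>x\<bar> = 1\<close>, and \<open>x \<noteq> 1\<close>
  if \<open>p = 1\<close>. For \<open>p = 1\<close> the series converges only conditionally, so it has to be the ordered
  sum \<open>suminf\<close> and not \<open>infsum\<close>.
\<close>
definition Li :: "nat \<Rightarrow> complex \<Rightarrow> complex \<Rightarrow> complex" where
  "Li p x c = (\<Sum>k. let n = Suc k; b = c - 1 in x ^ n / (of_nat n + b) ^ p)"

text \<open>
  The power \<open>x\<^sup>a\<close> of \<open>x = e\<^sup>i\<^sup>\<theta>\<close>. It depends on the choice of the argument \<open>\<theta>\<close>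
  (here in \<open>(0, 2\<pi>)\<close>), hence it takes \<open>\<theta>\<close> and not \<open>x\<close>; it differs from \<open>x powr a\<close>,
  which uses the argument in \<open>(-\<pi>, \<pi>]\<close>.
\<close>
definition arg_pow :: "real \<Rightarrow> complex \<Rightarrow> complex" where
  "arg_pow \<theta> a = exp (\<i> * a * of_real \<theta>)"

end

theory Submission
  imports Defs
begin

text \<open>
  For \<open>m = 0\<close> the left-hand side is the symmetric sum of \<open>x\<^sup>n / (n - a)\<close> over all integers \<open>n\<close>, and
  differentiating its partial sums \<open>m\<close> times in \<open>a\<close> gives \<open>m!\<close> times those for general \<open>m\<close>. So it
  suffices to show that the partial sums for \<open>m = 0\<close> converge to \<open>\<pi> x\<^sup>a (\<i> - cot (\<pi> a))\<close> locally
  uniformly in \<open>a\<close>. Multiplied by \<open>e\<^sup>-\<^sup>i\<^sup>a\<^sup>\<theta>\<close>, the \<open>N\<close>-th partial sum has a Dirichlet kernel as its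
  \<open>\<theta>\<close>-derivative, which has an antiderivative of size \<open>O(1/N)\<close> up to an error of the same order. Hence
  the limit of the product does not depend on \<open>\<theta>\<close>. At \<open>\<theta> = \<pi>\<close> the series converges absolutely once
  \<open>n\<close> and \<open>-n\<close> are paired, and its value \<open>-\<pi> / sin (\<pi> a)\<close> follows from the cotangent series at
  \<open>a\<close> and \<open>a / 2\<close>.
\<close>

section \<open>Symmetric partial sums and their derivatives in \<open>z\<close>\<close>

text \<open>This is the sum of x^n / (n - z)^(m+1) over -N <= n <= N. The terms with n = -k <= 0
  stand apart, in natural powers of \<open>inverse x\<close>; pulling the sign out of (-k - z)^(m+1)
  yields \<open>- (- 1) ^ m\<close>.\<close>

definition bilateral_sum :: "complex \<Rightarrow> nat \<Rightarrow> nat \<Rightarrow> complex \<Rightarrow> complex" where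
  "bilateral_sum x N m z =
     (\<Sum>k<N. x ^ Suc k / (of_nat (Suc k) - z) ^ Suc m)
     - (- 1) ^ m * (\<Sum>k<Suc N. inverse x ^ k / (of_nat k + z) ^ Suc m)"

lemma of_nat_diff_nonzero: "z \<notin> \<int> \<Longrightarrow> of_nat k - z \<noteq> (0::complex)"
  by (metis Ints_of_nat right_minus_eq)

lemma of_nat_add_nonzero: "z \<notin> \<int> \<Longrightarrow> of_nat k + z \<noteq> (0::complex)"
  by (metis Ints_minus Ints_of_nat add_eq_0_iff)

lemma sin_pi_times_nonzero: "z \<notin> \<int> \<Longrightarrow> sin (of_real pi * z) \<noteq> (0::complex)"
  by (auto simp: sin_eq_0 Ints_def)

lemma open_minus_Ints: "open (- \<int> :: complex set)"
  by (intro open_Compl closed_Ints)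

text \<open>Differentiating 1 / (k + z)^(m+1) yields a minus sign that turns (-1)^m into (-1)^(m+1),
  so both halves get the same factor m + 1.\<close>

lemma DERIV_bilateral_sum:
  assumes "z \<notin> \<int>"
  shows "(bilateral_sum x N m has_field_derivative of_nat (Suc m) * bilateral_sum x N (Suc m) z) (at z)"
proof -
  have 1: "((\<lambda>z. c / (of_nat (Suc k) - z) ^ Suc m) has_field_derivative
      of_nat (Suc m) * (c / (of_nat (Suc k) - z) ^ Suc (Suc m))) (at z)" for c k
    using of_nat_diff_nonzero[OF assms, of "Suc k"]
    by (auto intro!: derivative_eq_intros simp: divide_simps simp del: of_nat_Suc power_Suc)
       (auto simp: algebra_simps)
  have 2: "((\<lambda>z. c / (of_nat k + z) ^ Suc m) has_field_derivative
      - (of_nat (Suc m) * (c / (of_nat k + z) ^ Suc (Suc m)))) (at z)" for c k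
    using of_nat_add_nonzero[OF assms, of k]
    by (auto intro!: derivative_eq_intros simp: divide_simps simp del: of_nat_Suc power_Suc)
       (auto simp: algebra_simps)
  have "(bilateral_sum x N m has_field_derivative
      (\<Sum>k<N. of_nat (Suc m) * (x ^ Suc k / (of_nat (Suc k) - z) ^ Suc (Suc m)))
      - (- 1) ^ m * (\<Sum>k<Suc N. - (of_nat (Suc m) * (inverse x ^ k / (of_nat k + z) ^ Suc (Suc m))))) (at z)"
    unfolding bilateral_sum_def [abs_def] by (intro DERIV_diff DERIV_sum DERIV_cmult 1 2)
  then show ?thesis
    unfolding bilateral_sum_def
    by (simp only: sum_negf sum_distrib_left [symmetric])
       (simp add: algebra_simps del: of_nat_Suc sum.lessThan_Suc)
qed

lemma higher_deriv_bilateral_sum: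
  assumes "z \<notin> \<int>"
  shows "(deriv ^^ m) (bilateral_sum x N 0) z = fact m * bilateral_sum x N m z"
  using assms
proof (induction m arbitrary: z)
  case (Suc m)
  have "deriv ((deriv ^^ m) (bilateral_sum x N 0)) z = fact m * (of_nat (Suc m) * bilateral_sum x N (Suc m) z)"
  proof (rule DERIV_imp_deriv, rule has_field_derivative_transform_within_open)
    show "((\<lambda>w. fact m * bilateral_sum x N m w) has_field_derivative
      fact m * (of_nat (Suc m) * bilateral_sum x N (Suc m) z)) (at z)"
      using DERIV_bilateral_sum[OF Suc.prems] by (rule DERIV_cmult)
    \<comment> \<open>The induction hypothesis holds only off the integers, so the function is
      replaced on this open set and not everywhere.\<close>
    show "open (- \<int> :: complex set)" by (rule open_minus_Ints)
  qed (use Suc in auto)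
  then show ?case by (simp add: algebra_simps)
qed simp

section \<open>The cotangent series and the partial sums at 1 and -1\<close>

text \<open>Logarithmic differentiation of Gamma z * Gamma (1 - z) = pi / sin (pi z).\<close>

lemma Digamma_reflection_complex:
  fixes z :: complex
  assumes "z \<notin> \<int>"
  shows "Digamma (1 - z) - Digamma z = of_real pi * cot (of_real pi * z)"
proof -
  have [simp]: "z \<notin> \<int>\<^sub>\<le>\<^sub>0" "1 - z \<notin> \<int>\<^sub>\<le>\<^sub>0"
    using assms Ints_diff[OF Ints_1, of "1 - z"] nonpos_Ints_Int by auto
  let ?s = "sin (of_real pi * z)"
  have s: "?s \<noteq> 0" using assms by (rule sin_pi_times_nonzero)
  have "((\<lambda>z. Gamma z * Gamma (1 - z)) has_field_derivative
     Gamma z * Gamma (1 - z) * (Digamma z - Digamma (1 - z))) (at z)"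
    by (auto intro!: derivative_eq_intros simp: algebra_simps)
  moreover have "((\<lambda>z. of_real pi / sin (of_real pi * z)) has_field_derivative
     - (of_real pi / ?s * (of_real pi * cot (of_real pi * z)))) (at z)"
    using s by (auto intro!: derivative_eq_intros simp: cot_def field_simps)
  ultimately have "of_real pi / ?s * (Digamma z - Digamma (1 - z)) =
     - (of_real pi / ?s * (of_real pi * cot (of_real pi * z)))"
    unfolding Gamma_reflection_complex by (rule DERIV_unique)
  then have "of_real pi / ?s * (Digamma (1 - z) - Digamma z - of_real pi * cot (of_real pi * z)) = 0"
    by (simp add: algebra_simps)
  then show ?thesis using s by simp
qed

lemma tendsto_inverse_of_nat_add: "(\<lambda>k. inverse (of_nat k + c :: complex)) \<longlonglongrightarrow> 0"
  using filterlim_compose[OF tendsto_inverse_0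
          tendsto_add_filterlim_at_infinity[OF tendsto_const[of c] tendsto_of_nat]]
  by (simp add: add.commute)

text \<open>In the difference of the limit formulas for \<open>Digamma z\<close> and
  \<open>Digamma (1 - z)\<close> the logarithms cancel; the reflection formula gives the
  value.\<close>

lemma bilateral_sum_one_tendsto:
  assumes "z \<notin> \<int>"
  shows "(\<lambda>N. bilateral_sum 1 N 0 z) \<longlonglongrightarrow> - (of_real pi * cot (of_real pi * z))"
proof -
  have nz: "z \<noteq> 0" "1 - z \<noteq> 0" using assms by auto
  have a: "(\<lambda>N. inverse (z + of_nat N)) \<longlonglongrightarrow> 0"
    using tendsto_inverse_of_nat_add[of z] by (simp add: add.commute)
  \<comment> \<open>The subtracted \<open>inverse (z + of_nat N)\<close> is the term k = N of the
    second sum, which has N + 1 terms where the Digamma limit has N; it tends to 0.\<close>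
  have "(\<lambda>N. ((of_real (ln (real N)) - (\<Sum>n<N. inverse (z + of_nat n))) -
      (of_real (ln (real N)) - (\<Sum>n<N. inverse (1 - z + of_nat n)))) - inverse (z + of_nat N))
      \<longlonglongrightarrow> (Digamma z - Digamma (1 - z)) - 0"
    by (intro tendsto_diff Digamma_LIMSEQ nz a)
  also have "Digamma z - Digamma (1 - z) - 0 = - (of_real pi * cot (of_real pi * z))"
    using Digamma_reflection_complex[OF assms] by (simp add: algebra_simps)
  also have "(\<lambda>N. ((of_real (ln (real N)) - (\<Sum>n<N. inverse (z + of_nat n))) -
      (of_real (ln (real N)) - (\<Sum>n<N. inverse (1 - z + of_nat n)))) - inverse (z + of_nat N))
      = (\<lambda>N. bilateral_sum 1 N 0 z)"
    by (simp add: bilateral_sum_def fun_eq_iff inverse_eq_divide algebra_simps)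
  finally show ?thesis .
qed

lemma bilateral_sum_Suc:
  "bilateral_sum x (Suc N) 0 z = bilateral_sum x N 0 z +
     (x ^ Suc N / (of_nat (Suc N) - z) - inverse x ^ Suc N / (of_nat (Suc N) + z))"
  by (simp add: bilateral_sum_def del: of_nat_Suc power_Suc)

text \<open>Write (-1)^n as 2 [n even] - 1. With n = 2j, 2 / (2j - z) = 1 / (j - z/2), and
  truncation at 2N leaves exactly -N <= j <= N.\<close>

lemma bilateral_sum_minus_one_even:
  "bilateral_sum (-1) (2 * N) 0 z = bilateral_sum 1 N 0 (z / 2) - bilateral_sum 1 (2 * N) 0 z"
proof (induction N)
  case 0
  show ?case by (simp add: bilateral_sum_def)
next
  case (Suc N)
  have half: "1 / (of_nat (Suc N) - z / 2) = 2 / (of_nat (Suc (Suc (2 * N))) - z)"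
    "1 / (of_nat (Suc N) + z / 2) = 2 / (of_nat (Suc (Suc (2 * N))) + z)"
    by (auto simp: divide_simps) (auto simp: algebra_simps)
  have "2 * Suc N = Suc (Suc (2 * N))" by simp
  moreover have "(-1) ^ Suc (Suc (2 * N)) = (1::complex)" "(-1) ^ Suc (2 * N) = (-1::complex)"
    by simp_all
  ultimately show ?case
    by (simp only: bilateral_sum_Suc Suc.IH half power_one inverse_1 inverse_minus_eq) simp
qed

section \<open>Dirichlet kernel and dependence on the angle\<close>

lemma exp_i_of_real_neq_1:
  assumes "0 < t" "t < 2 * pi"
  shows "exp (\<i> * of_real t) \<noteq> 1"
proof
  assume "exp (\<i> * of_real t) = 1"
  then obtain n :: int where n: "t = of_int (2 * n) * pi"
    by (auto simp: exp_eq_1)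
  with assms have "0 < real_of_int n" "real_of_int n < 1"
    by (auto simp: zero_less_mult_iff)
  then show False by auto
qed

text \<open>The left-hand side is the sum of w^n over -N <= n <= N, a Dirichlet kernel for w =
  e^(it); times w - 1 it telescopes.\<close>

lemma bilateral_geometric_sum:
  fixes w :: complex
  assumes "w \<noteq> 0" "w \<noteq> 1"
  shows "(\<Sum>k<N. w ^ Suc k) + (\<Sum>k<Suc N. inverse w ^ k) = (w ^ Suc N - inverse w ^ N) / (w - 1)"
proof (induction N)
  case (Suc N)
  show ?case
    using Suc assms by (simp add: divide_simps) (auto simp: algebra_simps)
qed (use assms in auto)

lemma DERIV_exp_divide:
  fixes l t :: complex
  assumes "l \<noteq> 0"
  shows "((\<lambda>t. exp (\<i> * l * t) / l) has_field_derivative \<i> * exp (\<i> * l * t)) (at t within S)"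
    and "((\<lambda>t. exp (- (\<i> * l * t)) / l) has_field_derivative - (\<i> * exp (- (\<i> * l * t)))) (at t within S)"
  using assms by (auto intro!: derivative_eq_intros)

text \<open>The factor e^(-izt) turns the terms into e^(i(n-z)t) / (n-z), and differentiation
  cancels the denominators, so that a geometric sum remains.\<close>

lemma DERIV_exp_bilateral_sum:
  assumes "z \<notin> \<int>" "exp (\<i> * t) \<noteq> 1"
  shows "((\<lambda>t. exp (- (\<i> * z * t)) * bilateral_sum (exp (\<i> * t)) N 0 z) has_field_derivative
    \<i> * (exp (\<i> * (1/2 - z) * t) / (exp (\<i> * t) - 1)) *
      (exp (\<i> * (of_nat N + 1/2) * t) - exp (- (\<i> * (of_nat N + 1/2) * t)))) (at t within S)"
proof -
  have nz: "of_nat (Suc k) - z \<noteq> 0" "of_nat k + z \<noteq> 0" for k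
    using assms(1) of_nat_diff_nonzero of_nat_add_nonzero by blast+
  have eq: "exp (- (\<i> * z * t)) * bilateral_sum (exp (\<i> * t)) N 0 z =
     (\<Sum>k<N. exp (\<i> * (of_nat (Suc k) - z) * t) / (of_nat (Suc k) - z))
     - (\<Sum>k<Suc N. exp (- (\<i> * (of_nat k + z) * t)) / (of_nat k + z))" for t
  proof -
    have "exp (- (\<i> * z * t)) * (exp (\<i> * t) ^ Suc k / (of_nat (Suc k) - z) ^ Suc 0)
        = exp (\<i> * (of_nat (Suc k) - z) * t) / (of_nat (Suc k) - z)" for k
      by (simp add: exp_of_nat_mult[symmetric] exp_add[symmetric] algebra_simps del: power_Suc of_nat_Suc)
    moreover have "exp (- (\<i> * z * t)) * (inverse (exp (\<i> * t)) ^ k / (of_nat k + z) ^ Suc 0)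
        = exp (- (\<i> * (of_nat k + z) * t)) / (of_nat k + z)" for k
      by (simp add: exp_of_nat_mult[symmetric] exp_minus[symmetric] exp_add[symmetric] algebra_simps
          del: power_Suc of_nat_Suc)
    ultimately show ?thesis
      by (simp only: bilateral_sum_def right_diff_distrib sum_distrib_left power_0 mult_1_left)
  qed
  have 1: "((\<lambda>t. exp (\<i> * (of_nat (Suc k) - z) * t) / (of_nat (Suc k) - z)) has_field_derivative
     \<i> * exp (- (\<i> * z * t)) * exp (\<i> * t) ^ Suc k) (at t within S)" for k
    by (rule DERIV_cong[OF DERIV_exp_divide(1)[OF nz(1)]])
       (simp add: exp_of_nat_mult[symmetric] exp_add[symmetric] algebra_simps del: power_Suc of_nat_Suc)
  have 2: "((\<lambda>t. exp (- (\<i> * (of_nat k + z) * t)) / (of_nat k + z)) has_field_derivative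
     - (\<i> * exp (- (\<i> * z * t)) * inverse (exp (\<i> * t)) ^ k)) (at t within S)" for k
    by (rule DERIV_cong[OF DERIV_exp_divide(2)[OF nz(2)]])
       (simp add: exp_of_nat_mult[symmetric] exp_minus[symmetric] exp_add[symmetric] algebra_simps
          del: power_Suc of_nat_Suc)
  have "((\<lambda>t. exp (- (\<i> * z * t)) * bilateral_sum (exp (\<i> * t)) N 0 z) has_field_derivative
     (\<Sum>k<N. \<i> * exp (- (\<i> * z * t)) * exp (\<i> * t) ^ Suc k)
     - (\<Sum>k<Suc N. - (\<i> * exp (- (\<i> * z * t)) * inverse (exp (\<i> * t)) ^ k))) (at t within S)"
    unfolding eq by (intro DERIV_diff DERIV_sum 1 2)
  also have "(\<Sum>k<N. \<i> * exp (- (\<i> * z * t)) * exp (\<i> * t) ^ Suc k)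
     - (\<Sum>k<Suc N. - (\<i> * exp (- (\<i> * z * t)) * inverse (exp (\<i> * t)) ^ k))
     = \<i> * exp (- (\<i> * z * t)) * ((\<Sum>k<N. exp (\<i> * t) ^ Suc k) + (\<Sum>k<Suc N. inverse (exp (\<i> * t)) ^ k))"
    by (simp only: sum_distrib_left sum_negf distrib_left diff_minus_eq_add)
  also have "\<dots> = \<i> * exp (- (\<i> * z * t)) * (exp (\<i> * t) ^ Suc N - inverse (exp (\<i> * t)) ^ N) / (exp (\<i> * t) - 1)"
    using bilateral_geometric_sum[of "exp (\<i> * t)" N] assms(2) by simp
  \<comment> \<open>Taking out e^(it/2) turns the exponents N + 1 and -N into N + 1/2 and -(N +
    1/2), so the dependence on N sits in one oscillating factor.\<close>
  also have "\<dots> = \<i> * (exp (\<i> * (1/2 - z) * t) / (exp (\<i> * t) - 1)) *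
      (exp (\<i> * (of_nat N + 1/2) * t) - exp (- (\<i> * (of_nat N + 1/2) * t)))"
  proof -
    have "exp (- (\<i> * z * t)) * exp (\<i> * t) ^ Suc N =
        exp (\<i> * (1/2 - z) * t) * exp (\<i> * (of_nat N + 1/2) * t)"
      by (simp add: exp_of_nat_mult[symmetric] exp_add[symmetric] algebra_simps del: power_Suc)
    moreover have "exp (- (\<i> * z * t)) * inverse (exp (\<i> * t)) ^ N =
        exp (\<i> * (1/2 - z) * t) * exp (- (\<i> * (of_nat N + 1/2) * t))"
      by (simp add: exp_of_nat_mult[symmetric] exp_minus[symmetric] exp_add[symmetric] algebra_simps del: power_Suc)
    ultimately have "exp (- (\<i> * z * t)) * (exp (\<i> * t) ^ Suc N - inverse (exp (\<i> * t)) ^ N) =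
       exp (\<i> * (1/2 - z) * t) * (exp (\<i> * (of_nat N + 1/2) * t) - exp (- (\<i> * (of_nat N + 1/2) * t)))"
      unfolding right_diff_distrib by metis
    then show ?thesis by (simp only: mult.assoc times_divide_eq_right times_divide_eq_left)
  qed
  finally show ?thesis .
qed

lemma compact_continuous_norm_bound:
  fixes f :: "'a :: topological_space \<Rightarrow> complex"
  assumes "compact S" "continuous_on S f"
  obtains B where "B \<ge> 0" "\<And>x. x \<in> S \<Longrightarrow> norm (f x) \<le> B"
proof -
  have "bounded (f ` S)" using assms compact_continuous_image compact_imp_bounded by blast
  then obtain B where "\<And>x. x \<in> S \<Longrightarrow> norm (f x) \<le> B" by (auto simp: bounded_iff)
  \<comment> \<open>The maximum with 0 gives a nonnegative bound also when \<open>S\<close> is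
    empty.\<close>
  then have "norm (f x) \<le> max B 0" if "x \<in> S" for x using that by fastforce
  then show ?thesis by (intro that[of "max B 0"]) auto
qed

text \<open>Integration by parts against the oscillating factor, carried out as a mean value bound
  on the segment from \<theta> to pi.\<close>

lemma exp_bilateral_sum_diff_uniform_limit:
  assumes "0 < \<theta>" "\<theta> < 2 * pi" and K: "compact K" "K \<inter> \<int> = {}"
  shows "uniform_limit K (\<lambda>N z. exp (- (\<i> * z * of_real \<theta>)) * bilateral_sum (exp (\<i> * of_real \<theta>)) N 0 z
     - exp (- (\<i> * z * of_real pi)) * bilateral_sum (- 1) N 0 z) (\<lambda>_. 0) sequentially"
proof -
  \<comment> \<open>\<open>g z t * c N t\<close> is an antiderivative of the kernel up to \<open>g' z t * c N t\<close>, and \<open>c N t = O(1/N)\<close>.\<close>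
  define S where "S = closed_segment (complex_of_real \<theta>) (of_real pi)"
  define D where "D = (\<lambda>N z t. exp (- (\<i> * z * t)) * bilateral_sum (exp (\<i> * t)) N 0 z)"
  define g where "g = (\<lambda>z t. exp (\<i> * (1/2 - z) * t) / (exp (\<i> * t) - 1))"
  define g' where "g' = (\<lambda>z t. (\<i> * (1/2 - z) * exp (\<i> * (1/2 - z) * t) * (exp (\<i> * t) - 1)
      - exp (\<i> * (1/2 - z) * t) * (\<i> * exp (\<i> * t))) / (exp (\<i> * t) - 1)\<^sup>2)"
  define c where "c = (\<lambda>N t. (exp (\<i> * (of_nat N + 1/2) * t) + exp (- (\<i> * (of_nat N + 1/2) * t)))
      / (of_nat N + 1/2))"
  \<comment> \<open>The segment stays inside (0, 2 pi), where exp (i t) - 1, which occurs in the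
    denominators of \<open>g\<close> and \<open>g'\<close>, has no zero.\<close>
  have S: "\<exists>s. t = of_real s \<and> 0 < s \<and> s < 2 * pi" if "t \<in> S" for t
    using that assms(1,2) pi_gt_zero
    by (auto simp: S_def closed_segment_of_real closed_segment_eq_real_ivl split: if_splits)
  have e1: "exp (\<i> * t) \<noteq> 1" if "t \<in> S" for t
    using S[OF that] exp_i_of_real_neq_1 by auto
  have lam: "complex_of_nat N + 1/2 = of_real (real N + 1/2)" for N by simp
  have nc: "norm (c N t) \<le> 2 / (real N + 1/2)" if t: "t \<in> S" for N t
  proof -
    obtain s where s: "t = of_real s" using S[OF t] by blast
    have "norm (exp (\<i> * (of_nat N + 1/2) * t) + exp (- (\<i> * (of_nat N + 1/2) * t))) \<le> 1 + 1"
      unfolding lam s by (rule norm_triangle_mono) (simp_all add: norm_exp_eq_Re)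
    then show ?thesis
      unfolding c_def norm_divide unfolding lam norm_of_real by (intro frac_le) auto
  qed
  \<comment> \<open>Compactness in both variables makes the bounds \<open>G\<close> and
    \<open>B\<close> independent of \<open>z\<close>.\<close>
  have cp: "compact (K \<times> S)" using K unfolding S_def by (intro compact_Times) auto
  have "continuous_on (K \<times> S) (\<lambda>p. g (fst p) (snd p))"
    unfolding g_def using e1 by (auto intro!: continuous_intros)
  then obtain G where G: "G \<ge> 0" "\<And>p. p \<in> K \<times> S \<Longrightarrow> norm (g (fst p) (snd p)) \<le> G"
    using compact_continuous_norm_bound[OF cp] by blast
  have "continuous_on (K \<times> S) (\<lambda>p. g' (fst p) (snd p))"
    unfolding g'_def using e1 by (auto intro!: continuous_intros)
  then obtain B where B: "B \<ge> 0" "\<And>p. p \<in> K \<times> S \<Longrightarrow> norm (g' (fst p) (snd p)) \<le> B"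
    using compact_continuous_norm_bound[OF cp] by blast
  \<comment> \<open>The first term is the mean value bound over the segment, with |c| <= 2 / (N +
    1/2); the second collects |g c| <= 2 G / (N + 1/2) at the two endpoints.\<close>
  define M where "M = B * 2 * norm (complex_of_real \<theta> - of_real pi) + 4 * G"
  have bound: "norm (D N z (of_real \<theta>) - D N z (of_real pi)) \<le> M / (real N + 1/2)" if z: "z \<in> K" for N z
  proof -
    have zi: "z \<notin> \<int>" using z K by blast
    let ?H = "\<lambda>t. D N z t - g z t * c N t"
    have ends: "of_real \<theta> \<in> S" "of_real pi \<in> S" by (auto simp: S_def)
    have nl: "complex_of_nat N + 1/2 \<noteq> 0" unfolding lam of_real_eq_0_iff by linarith
    have dH: "(?H has_field_derivative - (g' z t * c N t)) (at t within S)" if t: "t \<in> S" for t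
    proof -
      have dg: "(g z has_field_derivative g' z t) (at t within S)"
        unfolding g_def g'_def using e1[OF t]
        by (auto intro!: derivative_eq_intros simp: power2_eq_square)
      have dc: "(c N has_field_derivative
          \<i> * (exp (\<i> * (of_nat N + 1/2) * t) - exp (- (\<i> * (of_nat N + 1/2) * t)))) (at t within S)"
        unfolding c_def add_divide_distrib
        by (rule DERIV_cong[OF DERIV_add[OF DERIV_exp_divide[OF nl]]]) (simp add: right_diff_distrib)
      show ?thesis
        unfolding D_def
        by (rule DERIV_cong, rule DERIV_diff[OF DERIV_exp_bilateral_sum[OF zi e1[OF t]] DERIV_mult[OF dg dc]])
           (simp add: g_def)
    qed
    have "norm (?H (of_real \<theta>) - ?H (of_real pi)) \<le> B * (2 / (real N + 1/2)) * norm (complex_of_real \<theta> - of_real pi)"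
    proof (rule field_differentiable_bound[OF _ dH])
      show "norm (- (g' z t * c N t)) \<le> B * (2 / (real N + 1/2))" if "t \<in> S" for t
        unfolding norm_minus_cancel norm_mult
        using B(2)[of "(z, t)"] nc[OF that, of N] z that B(1) by (intro mult_mono) auto
    qed (use ends in \<open>auto simp: S_def\<close>)
    moreover have gc: "norm (g z t * c N t) \<le> G * (2 / (real N + 1/2))" if "t \<in> S" for t
      unfolding norm_mult using G(2)[of "(z, t)"] nc[OF that, of N] z that G(1) by (intro mult_mono) auto
    moreover have "norm (D N z (of_real \<theta>) - D N z (of_real pi)) \<le>
      norm (?H (of_real \<theta>) - ?H (of_real pi)) + (norm (g z (of_real \<theta>) * c N (of_real \<theta>))
         + norm (g z (of_real pi) * c N (of_real pi)))"
    proof -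
      have "D N z (of_real \<theta>) - D N z (of_real pi) = (?H (of_real \<theta>) - ?H (of_real pi)) +
        (g z (of_real \<theta>) * c N (of_real \<theta>) - g z (of_real pi) * c N (of_real pi))" by simp
      then show ?thesis by (metis norm_triangle_le norm_triangle_ineq4 add_left_mono)
    qed
    ultimately have "norm (D N z (of_real \<theta>) - D N z (of_real pi)) \<le>
       B * (2 / (real N + 1/2)) * norm (complex_of_real \<theta> - of_real pi) + (G * (2 / (real N + 1/2)) + G * (2 / (real N + 1/2)))"
      using ends gc[OF ends(1)] gc[OF ends(2)] by linarith
    also have "\<dots> = M / (real N + 1/2)"
      unfolding M_def by (simp add: add_divide_distrib)
    finally show ?thesis .
  qed
  have "uniform_limit K (\<lambda>N z. D N z (of_real \<theta>) - D N z (of_real pi)) (\<lambda>_. 0) sequentially"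
  proof (rule uniform_limitI)
    fix e :: real assume "e > 0"
    have "(\<lambda>N. M / (real N + 1/2)) \<longlonglongrightarrow> 0" by real_asymp
    then have "eventually (\<lambda>N. M / (real N + 1/2) < e) sequentially"
      using \<open>e > 0\<close> by (rule order_tendstoD)
    then show "\<forall>\<^sub>F N in sequentially. \<forall>z\<in>K. dist (D N z (of_real \<theta>) - D N z (of_real pi)) 0 < e"
      by eventually_elim (use bound in \<open>auto simp: dist_norm intro: le_less_trans\<close>)
  qed
  then show ?thesis by (simp add: D_def)
qed

section \<open>Convergence of the series that define \<open>Li\<close>\<close>

text \<open>For k > 2 |c| the reverse triangle inequality gives |k + c| >= k/2, whence the factor
  4.\<close>

lemma summable_inverse_norm_square_shift:
  fixes c :: complex
  shows "summable (\<lambda>k. inverse (norm (of_nat k + c) ^ 2))"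
proof (rule summable_comparison_test_ev)
  have "eventually (\<lambda>k. real k > 2 * norm c) sequentially" by real_asymp
  then show "eventually (\<lambda>k. norm (inverse (norm (of_nat k + c) ^ 2)) \<le> 4 * inverse (real k ^ 2)) sequentially"
  proof eventually_elim
    case (elim k)
    have "real k / 2 \<le> norm (of_nat k + c)"
      using elim norm_diff_ineq[of "of_nat k" c] by simp
    moreover have "real k / 2 > 0" using elim norm_ge_zero[of c] by linarith
    ultimately have "inverse (norm (of_nat k + c) ^ 2) \<le> inverse ((real k / 2) ^ 2)"
      by (intro le_imp_inverse_le power_mono) auto
    then show ?case by (simp add: field_simps)
  qed
  show "summable (\<lambda>k. 4 * inverse (real k ^ 2))"
    using inverse_power_summable[of 2, where 'a = real] by (intro summable_mult) simp
qed

text \<open>Summation by parts: with b k = 1 / (k + c), (x - 1) x^k b k is a telescoping difference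
  plus x^(k+1) (b k - b (k+1)). The first part is summable as b k tends to 0, the second converges
  absolutely, and division by x - 1 is possible.\<close>

lemma summable_unit_power_div_linear:
  fixes x c :: complex
  assumes x: "norm x = 1" "x \<noteq> 1" and c: "c \<notin> \<int>"
  shows "summable (\<lambda>k. x ^ k / (of_nat k + c))"
proof -
  let ?b = "\<lambda>k. inverse (of_nat k + c)"
  have nz: "of_nat k + c \<noteq> 0" for k using c by (rule of_nat_add_nonzero)
  have "(\<lambda>k. x ^ k * ?b k) \<longlonglongrightarrow> 0"
    by (rule tendsto_norm_zero_cancel)
       (use x tendsto_inverse_of_nat_add[of c] in \<open>simp add: norm_mult norm_power tendsto_norm_zero_iff\<close>)
  then have 1: "summable (\<lambda>k. x ^ Suc k * ?b (Suc k) - x ^ k * ?b k)"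
    by (rule telescope_summable)
  have 2: "summable (\<lambda>k. x ^ Suc k * (?b k - ?b (Suc k)))"
  proof (rule summable_norm_cancel, rule summable_comparison_test')
    let ?g = "\<lambda>k. inverse (norm (of_nat k + c) ^ 2)"
    show "summable (\<lambda>k. ?g k + ?g (Suc k))"
      using summable_inverse_norm_square_shift[of c]
        summable_Suc_iff[where f = ?g, THEN iffD2, OF summable_inverse_norm_square_shift]
      by (rule summable_add)
    show "norm (norm (x ^ Suc k * (?b k - ?b (Suc k)))) \<le> ?g k + ?g (Suc k)" if "k \<ge> 0" for k
    proof -
      have "?b k - ?b (Suc k) = ?b k * ?b (Suc k)"
        using nz[of k] nz[of "Suc k"] by (simp add: inverse_diff_inverse)
      then have "norm (norm (x ^ Suc k * (?b k - ?b (Suc k)))) = norm (?b k) * norm (?b (Suc k))"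
        using x by (simp add: norm_mult norm_power)
      \<comment> \<open>From 2 u v <= u^2 + v^2 and u v >= 0. This separates the neighbouring
        indices, so that the series of squares applies to each.\<close>
      also have "\<dots> \<le> norm (?b k) ^ 2 + norm (?b (Suc k)) ^ 2"
        using sum_squares_bound[of "norm (?b k)" "norm (?b (Suc k))"]
          mult_nonneg_nonneg[OF norm_ge_zero[of "?b k"] norm_ge_zero[of "?b (Suc k)"]] by linarith
      finally show ?thesis by (simp only: norm_inverse power_inverse)
    qed
  qed
  have "summable (\<lambda>k. (x ^ Suc k * ?b (Suc k) - x ^ k * ?b k) + x ^ Suc k * (?b k - ?b (Suc k)))"
    using 1 2 by (rule summable_add)
  also have "(\<lambda>k. (x ^ Suc k * ?b (Suc k) - x ^ k * ?b k) + x ^ Suc k * (?b k - ?b (Suc k)))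
      = (\<lambda>k. (x - 1) * (x ^ k * ?b k))"
    by (simp add: algebra_simps)
  finally show ?thesis
    using x(2) by (simp add: divide_inverse summable_cmult_iff)
qed

text \<open>For m = 0 this is the conditionally convergent case; for m >= 1 the terms are eventually
  dominated by 1 / |k + c|^2.\<close>

lemma summable_unit_power_div:
  fixes x c :: complex
  assumes x: "norm x = 1" "x \<noteq> 1" and c: "c \<notin> \<int>"
  shows "summable (\<lambda>k. x ^ k / (of_nat k + c) ^ Suc m)"
proof (cases "m = 0")
  case True
  then show ?thesis using summable_unit_power_div_linear[OF assms] by simp
next
  case False
  show ?thesis
  proof (rule summable_norm_cancel, rule summable_comparison_test_ev)
    \<comment> \<open>Beyond this index |k + c| >= 1, so raising the exponent from 2 to m + 1 cannot
      shrink the denominator.\<close>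
    have "eventually (\<lambda>k. real k > norm c + 1) sequentially" by real_asymp
    then show "\<forall>\<^sub>F k in sequentially. norm (norm (x ^ k / (of_nat k + c) ^ Suc m))
        \<le> inverse (norm (of_nat k + c) ^ 2)"
    proof eventually_elim
      case (elim k)
      then have "1 \<le> norm (of_nat k + c)"
        using norm_diff_ineq[of "of_nat k" c] by simp
      then have "norm (of_nat k + c) ^ 2 \<le> norm (of_nat k + c) ^ Suc m" "0 < norm (of_nat k + c)"
        using False by (auto intro!: power_increasing simp del: power_Suc)
      then have "inverse (norm (of_nat k + c) ^ Suc m) \<le> inverse (norm (of_nat k + c) ^ 2)"
        by (intro le_imp_inverse_le) auto
      then show ?case using x by (simp add: norm_divide norm_power inverse_eq_divide del: power_Suc)
    qed
  qed (rule summable_inverse_norm_square_shift)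
qed

text \<open>With n = k + 1 and b = c - 1 the denominator n + b is k + c.\<close>

lemma Li_sums:
  assumes "norm x = 1" "x \<noteq> 1" "c \<notin> \<int>"
  shows "(\<lambda>k. x ^ Suc k / (of_nat k + c) ^ Suc m) sums Li (Suc m) x c"
proof -
  have "summable (\<lambda>k. x * (x ^ k / (of_nat k + c) ^ Suc m))"
    using summable_unit_power_div[OF assms] by (rule summable_mult)
  then have "summable (\<lambda>k. x ^ Suc k / (of_nat k + c) ^ Suc m)" by simp
  then show ?thesis
    unfolding Li_def Let_def by (simp add: summable_sums_iff algebra_simps)
qed

lemma bilateral_sum_tendsto_Li:
  assumes x: "norm x = 1" "x \<noteq> 1" and a: "a \<notin> \<int>"
  shows "(\<lambda>N. bilateral_sum x N m a) \<longlonglongrightarrow>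
    Li (Suc m) x (1 - a) - (- 1) ^ m * x * Li (Suc m) (inverse x) a"
proof -
  have "1 - a \<notin> \<int>" using a Ints_diff[OF Ints_1, of "1 - a"] by auto
  then have 1: "(\<lambda>k. x ^ Suc k / (of_nat k + (1 - a)) ^ Suc m) sums Li (Suc m) x (1 - a)"
    by (intro Li_sums x)
  \<comment> \<open>\<open>Li\<close> starts at the power 1 of \<open>inverse x\<close> but the
    second sum at the power 0; the factor \<open>x\<close> makes up for this.\<close>
  have "(\<lambda>k. x * (inverse x ^ Suc k / (of_nat k + a) ^ Suc m)) sums (x * Li (Suc m) (inverse x) a)"
    using x a by (intro sums_mult Li_sums) (auto simp: norm_inverse)
  also have "(\<lambda>k. x * (inverse x ^ Suc k / (of_nat k + a) ^ Suc m)) =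
     (\<lambda>k. inverse x ^ k / (of_nat k + a) ^ Suc m)"
  proof -
    have "x \<noteq> 0" using x by auto
    then show ?thesis by (simp add: mult.assoc [symmetric])
  qed
  finally have "(\<lambda>k. inverse x ^ k / (of_nat k + a) ^ Suc m) sums (x * Li (Suc m) (inverse x) a)" .
  \<comment> \<open>The second sum has one term more than the first, hence the shift of the sequence
    by one.\<close>
  then have "(\<lambda>N. \<Sum>k<Suc N. inverse x ^ k / (of_nat k + a) ^ Suc m) \<longlonglongrightarrow> x * Li (Suc m) (inverse x) a"
    unfolding sums_def by (rule LIMSEQ_Suc)
  from tendsto_diff[OF 1[unfolded sums_def] tendsto_mult[OF tendsto_const[of "(-1) ^ m"] this]]
  show ?thesis
    unfolding bilateral_sum_def by (simp add: algebra_simps del: sum.lessThan_Suc power_Suc)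
qed

section \<open>Limit at the angle pi\<close>

text \<open>The parity identity controls only even indices. Convergence is therefore assumed, and
  the even subsequence determines the limit from the cotangent values at z/2 and z.\<close>

lemma bilateral_sum_minus_one_tendsto:
  assumes z: "z \<notin> \<int>" and conv: "(\<lambda>N. bilateral_sum (- 1) N 0 z) \<longlonglongrightarrow> l"
  shows "l = - (of_real pi / sin (of_real pi * z))"
proof -
  have z2: "z / 2 \<notin> \<int>"
    using z Ints_mult[of 2 "z / 2"] by auto
  have sub: "filterlim (\<lambda>N. 2 * N :: nat) sequentially sequentially"
    by (rule filterlim_subseq) (auto simp: strict_mono_def)
  have "(\<lambda>N. bilateral_sum (- 1) (2 * N) 0 z) \<longlonglongrightarrow>
     - (of_real pi * cot (of_real pi * (z / 2))) - - (of_real pi * cot (of_real pi * z))"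
    unfolding bilateral_sum_minus_one_even
    by (intro tendsto_diff bilateral_sum_one_tendsto z z2 filterlim_compose[OF bilateral_sum_one_tendsto[OF z] sub])
  moreover have "(\<lambda>N. bilateral_sum (- 1) (2 * N) 0 z) \<longlonglongrightarrow> l"
    by (rule filterlim_compose[OF conv sub])
  ultimately have l: "l = of_real pi * (cot (of_real pi * z) - cot (of_real pi * z / 2))"
    using LIMSEQ_unique by (force simp: algebra_simps)
  \<comment> \<open>Half angle, for the identity cot (2w) - cot w = -1 / sin (2w).\<close>
  define w where "w = of_real pi * z / 2"
  have "of_real pi * z = 2 * w" by (simp add: w_def)
  moreover have "sin w \<noteq> 0" "sin (2 * w) \<noteq> 0"
    using sin_pi_times_nonzero[OF z] sin_pi_times_nonzero[OF z2] by (simp_all add: w_def)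
  then have "cot (2 * w) - cot w = - 1 / sin (2 * w)"
    by (simp add: cot_def sin_double cos_double_cos divide_simps) (simp add: power2_eq_square algebra_simps)
  ultimately show ?thesis unfolding l w_def[symmetric] by simp
qed

text \<open>Pairing n with -n gives (-1)^n 2z / (n^2 - z^2), of order 1/n^2 uniformly on
  \<open>K\<close>; the term n = 0 is -1/z.\<close>

lemma bilateral_sum_minus_one_uniform_limit:
  assumes K: "compact K" "K \<inter> \<int> = {}"
  shows "uniform_limit K (\<lambda>N. bilateral_sum (- 1) N 0) (\<lambda>z. - (of_real pi / sin (of_real pi * z))) sequentially"
proof -
  define f where "f = (\<lambda>k z. (- 1) ^ Suc k * (2 * z) / (of_nat (Suc k) ^ 2 - z ^ 2 :: complex))"
  have f: "bilateral_sum (- 1) N 0 z = - 1 / z + (\<Sum>k<N. f k z)" if "z \<in> K" for N z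
  proof -
    have zi: "z \<notin> \<int>" using that K by blast
    have "f k z = (- 1) ^ Suc k / (of_nat (Suc k) - z) - (- 1) ^ Suc k / (of_nat (Suc k) + z)" for k
    proof -
      have "of_nat (Suc k) ^ 2 - z ^ 2 = (of_nat (Suc k) - z) * (of_nat (Suc k) + z)"
        by (simp add: algebra_simps power2_eq_square)
      then show ?thesis
        using of_nat_diff_nonzero[OF zi, of "Suc k"] of_nat_add_nonzero[OF zi, of "Suc k"]
        unfolding f_def by (simp add: divide_simps del: of_nat_Suc power_Suc) (simp add: algebra_simps)
    qed
    then show ?thesis
      unfolding bilateral_sum_def sum.lessThan_Suc_shift
      by (simp add: sum_subtractf del: of_nat_Suc power_Suc)
  qed
  obtain R where R: "R \<ge> 0" "\<And>z. z \<in> K \<Longrightarrow> norm z \<le> R"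
    using compact_continuous_norm_bound[OF K(1) continuous_on_id] by auto
  have "uniformly_convergent_on K (\<lambda>N z. \<Sum>k<N. f k z)"
  proof (rule Weierstrass_m_test'_ev)
    \<comment> \<open>Since |z| <= R on \<open>K\<close>, n^2 > 2 R^2 gives |n^2 - z^2| >= n^2 / 2
      for n = k + 1.\<close>
    have "eventually (\<lambda>k. real (Suc k) ^ 2 > 2 * R ^ 2) sequentially" by real_asymp
    then show "\<forall>\<^sub>F k in sequentially. \<forall>z\<in>K. norm (f k z) \<le> 4 * R * inverse (real (Suc k) ^ 2)"
    proof eventually_elim
      case (elim k)
      show ?case
      proof
        fix z assume z: "z \<in> K"
        have "norm z ^ 2 \<le> R ^ 2" using R(2)[OF z] by (intro power_mono) auto
        then have d: "real (Suc k) ^ 2 / 2 \<le> norm (of_nat (Suc k) ^ 2 - z ^ 2)"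
          using elim norm_triangle_ineq2[of "of_nat (Suc k) ^ 2" "z ^ 2"]
          unfolding norm_power norm_of_nat by linarith
        have "norm (f k z) = 2 * norm z / norm (of_nat (Suc k) ^ 2 - z ^ 2)"
          by (simp add: f_def norm_divide norm_mult norm_power del: of_nat_Suc)
        also have "\<dots> \<le> 2 * R / (real (Suc k) ^ 2 / 2)"
          using R z d by (intro frac_le) auto
        finally show "norm (f k z) \<le> 4 * R * inverse (real (Suc k) ^ 2)"
          by (simp add: inverse_eq_divide del: of_nat_Suc)
      qed
    qed
    have "summable (\<lambda>k. inverse (real (Suc k) ^ 2))"
      using inverse_power_summable[of 2, where 'a = real] by (subst summable_Suc_iff) simp
    then show "summable (\<lambda>k. 4 * R * inverse (real (Suc k) ^ 2))" by (rule summable_mult)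
  qed
  then obtain l where l: "uniform_limit K (\<lambda>N z. \<Sum>k<N. f k z) l sequentially"
    unfolding uniformly_convergent_on_def by blast
  have "uniform_limit K (\<lambda>N z. - 1 / z + (\<Sum>k<N. f k z)) (\<lambda>z. - 1 / z + l z) sequentially"
    by (intro uniform_limit_add uniform_limit_const l)
  then have u: "uniform_limit K (\<lambda>N. bilateral_sum (- 1) N 0) (\<lambda>z. - 1 / z + l z) sequentially"
    by (rule uniform_limit_cong'[THEN iffD1, rotated -1]) (simp_all add: f)
  \<comment> \<open>The M-test yields only some limit \<open>l\<close>; its values come from the
    pointwise result, applied to the convergence just shown.\<close>
  have "- 1 / z + l z = - (of_real pi / sin (of_real pi * z))" if "z \<in> K" for z
    using bilateral_sum_minus_one_tendsto[OF _ tendsto_uniform_limitI[OF u that]] that K by blast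
  then show ?thesis
    using u by (simp cong: uniform_limit_cong')
qed

section \<open>Limit at a general angle and its derivatives\<close>

text \<open>By comparison with the angle pi, the partial sums times e^(-iz\<theta>) tend to -pi
  e^(-i pi z) / sin (pi z); multiplying by e^(iz\<theta>) undoes the first factor.\<close>

lemma bilateral_sum_uniform_limit:
  assumes \<theta>: "0 < \<theta>" "\<theta> < 2 * pi" and K: "compact K" "K \<inter> \<int> = {}"
  shows "uniform_limit K (\<lambda>N. bilateral_sum (exp (\<i> * of_real \<theta>)) N 0)
    (\<lambda>z. of_real pi * (\<i> * arg_pow \<theta> z - cot (of_real pi * z) * arg_pow \<theta> z)) sequentially"
proof -
  let ?S = "\<lambda>N. bilateral_sum (exp (\<i> * of_real \<theta>)) N 0"
  let ?T = "\<lambda>N. bilateral_sum (- 1) N 0"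
  have s: "sin (of_real pi * z) \<noteq> 0" if "z \<in> K" for z
    using that K by (intro sin_pi_times_nonzero) auto
  \<comment> \<open>The rule for products of uniform limits asks for bounded limit functions;
    continuity on the compact set provides this.\<close>
  have bdd: "bounded (f ` K)" if "continuous_on K f" for f :: "complex \<Rightarrow> complex"
    using compact_continuous_image[OF that K(1)] by (rule compact_imp_bounded)
  have "uniform_limit K (\<lambda>N z. (exp (- (\<i> * z * of_real \<theta>)) * ?S N z - exp (- (\<i> * z * of_real pi)) * ?T N z)
      + exp (- (\<i> * z * of_real pi)) * ?T N z)
     (\<lambda>z. 0 + exp (- (\<i> * z * of_real pi)) * (- (of_real pi / sin (of_real pi * z)))) sequentially"
    by (intro uniform_limit_add exp_bilateral_sum_diff_uniform_limit \<theta> K uniform_lim_mult uniform_limit_const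
         bilateral_sum_minus_one_uniform_limit bdd continuous_intros) (use s in auto)
  then have "uniform_limit K (\<lambda>N z. arg_pow \<theta> z * ((exp (- (\<i> * z * of_real \<theta>)) * ?S N z - exp (- (\<i> * z * of_real pi)) * ?T N z)
      + exp (- (\<i> * z * of_real pi)) * ?T N z))
     (\<lambda>z. arg_pow \<theta> z * (0 + exp (- (\<i> * z * of_real pi)) * (- (of_real pi / sin (of_real pi * z))))) sequentially"
    unfolding arg_pow_def
    by (intro uniform_lim_mult uniform_limit_const bdd continuous_intros) (use s in auto)
  then show ?thesis
  proof (rule uniform_limit_cong'[THEN iffD1, rotated -1])
    show "arg_pow \<theta> z * ((exp (- (\<i> * z * of_real \<theta>)) * ?S N z - exp (- (\<i> * z * of_real pi)) * ?T N z)
      + exp (- (\<i> * z * of_real pi)) * ?T N z) = ?S N z" for N z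
      by (simp add: arg_pow_def exp_minus)
    show "arg_pow \<theta> z * (0 + exp (- (\<i> * z * of_real pi)) * (- (of_real pi / sin (of_real pi * z)))) =
      of_real pi * (\<i> * arg_pow \<theta> z - cot (of_real pi * z) * arg_pow \<theta> z)" if "z \<in> K" for z
    proof -
      \<comment> \<open>Euler's formula gives -e^(-i pi z) / sin (pi z) = i - cot (pi z).\<close>
      have "exp (- (\<i> * z * of_real pi)) = cos (of_real pi * z) - \<i> * sin (of_real pi * z)"
        using exp_Euler[of "- (of_real pi * z)"] by (simp add: mult_ac)
      then show ?thesis unfolding cot_def using s[OF that] by (simp only:) (simp add: field_simps)
    qed
  qed
qed

theorem theorem2p7:
  fixes \<theta> :: real and x a :: complex and m :: nat
  assumes "0 < \<theta>" and "\<theta> < 2 * pi"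
    and "x = exp (\<i> * of_real \<theta>)"
    and "a \<notin> \<int>"
  shows "Li (m + 1) x (1 - a) - (- 1) ^ m * x * Li (m + 1) (inverse x) a
       = of_real pi / fact m *
           (deriv ^^ m) (\<lambda>z. \<i> * arg_pow \<theta> z - cot (of_real pi * z) * arg_pow \<theta> z) a"
proof -
  let ?G = "\<lambda>z. \<i> * arg_pow \<theta> z - cot (of_real pi * z) * arg_pow \<theta> z"
  \<comment> \<open>A closed disc off the integers serves as the compact set on which the
    convergence is uniform.\<close>
  obtain r where r: "r > 0" "cball a r \<subseteq> - \<int>"
    using open_minus_Ints assms(4) by (meson ComplI open_contains_cball)
  have x: "norm x = 1" "x \<noteq> 1"
    using assms exp_i_of_real_neq_1 by (simp_all add: norm_exp_eq_Re)
  have nI: "z \<notin> \<int>" if "z \<in> ball a r" for z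
    using that r(2) by (force simp: subset_iff)
  \<comment> \<open>Weierstrass: for holomorphic functions, uniform convergence on a disc carries
    over to the derivatives at its centre.\<close>
  have "(\<lambda>N. (deriv ^^ m) (bilateral_sum x N 0) a) \<longlonglongrightarrow> (deriv ^^ m) (\<lambda>z. of_real pi * ?G z) a"
  proof (rule higher_deriv_complex_uniform_limit)
    show "uniform_limit (ball a r) (\<lambda>N. bilateral_sum x N 0) (\<lambda>z. of_real pi * ?G z) sequentially"
      unfolding assms(3) using r(2)
      by (intro uniform_limit_on_subset[OF bilateral_sum_uniform_limit[OF assms(1,2)], of "cball a r"]) auto
    show "\<forall>\<^sub>F N in sequentially. bilateral_sum x N 0 holomorphic_on ball a r"
      using DERIV_bilateral_sum nI
      by (intro always_eventually allI holomorphic_onI)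
         (meson field_differentiable_at_within field_differentiable_def)
  qed (use r in auto)
  moreover have "(deriv ^^ m) (\<lambda>z. of_real pi * ?G z) a = of_real pi * (deriv ^^ m) ?G a"
  proof (rule higher_deriv_cmult)
    show "?G holomorphic_on ball a r"
      unfolding arg_pow_def cot_def using nI sin_pi_times_nonzero by (auto intro!: holomorphic_intros)
  qed (use r in auto)
  ultimately have "(\<lambda>N. fact m * bilateral_sum x N m a) \<longlonglongrightarrow> of_real pi * (deriv ^^ m) ?G a"
    by (simp add: higher_deriv_bilateral_sum[OF assms(4)])
  \<comment> \<open>The same sequence, read as partial sums of the two \<open>Li\<close> series;
    uniqueness of limits then equates the two sides.\<close>
  moreover have "(\<lambda>N. fact m * bilateral_sum x N m a) \<longlonglongrightarrow>
      fact m * (Li (Suc m) x (1 - a) - (- 1) ^ m * x * Li (Suc m) (inverse x) a)"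
    by (intro tendsto_mult tendsto_const bilateral_sum_tendsto_Li x assms(4))
  ultimately have "fact m * (Li (Suc m) x (1 - a) - (- 1) ^ m * x * Li (Suc m) (inverse x) a) =
      of_real pi * (deriv ^^ m) ?G a"
    using LIMSEQ_unique by blast
  then show ?thesis by (simp add: field_simps)
qed

end
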